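(* Let $a\in\mathbb{R}$, and let $x:\mathbb{Z}_a\to\mathbb{R}$ and $w:\mathbb{Z}_a\to\mathbb{R}\setminus\{0\}$. Then for every $k\in\mathbb{N}_{a+1}$ the following hold. (1) If $\alpha\in\mathbb{R}\setminus\mathbb{Z}_+$, then $${}_a^{\rm G}\nabla_k^{\alpha,w(k)}x(k)=\sum_{i=0}^{k-a-1}\binom{\alpha}{i}\frac{(k-a-i)^{\overline{i-\alpha}}}{\Gamma(i-\alpha+1)}\nabla^{i,w(k)}x(k).$$ (2) If $n\in\mathbb{Z}_+$ and $\alpha\in(n-1,n)$, then $${}_a^{\rm R}\nabla_k^{\alpha,w(k)}x(k)=\sum_{i=0}^{k-a-1}\binom{\alpha}{i}\frac{(k-a-i)^{\overline{i-\alpha}}}{\Gamma(i-\alpha+1)}\nabla^{i,w(k)}x(k).$$ (3) If $n\in\mathbb{Z}_+$ and $\alpha\in(n-1,n)$, then $${}_a^{\rm C}\nabla_k^{\alpha,w(k)}x(k)=\sum_{i=n}^{k-a-1+n}\binom{\alpha-n}{i-n}\frac{(k-a-i+n)^{\overline{i-\alpha}}}{\Gamma(i-\alpha+1)}\nabla^{i,w(k)}x(k).$$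
   Context: For $b\in\mathbb{R}$, $\mathbb{N}_b=\{b,b+1,b+2,\dots\}$ and $\mathbb{Z}_a=\{\dots,a-2,a-1,a,a+1,a+2,\dots\}$; $\mathbb{Z}_+=\{1,2,\dots\}$. $p^{\overline{q}}=\Gamma(p+q)/\Gamma(p)$ is the rising function. $\binom{p}{i}=\frac{p(p-1)\cdots(p-i+1)}{i!}$ for real $p$ and integer $i\ge 0$. Nabla difference: $\nabla^n z(k)=\sum_{i=0}^n(-1)^i\binom{n}{i}z(k-i)$, with $\nabla^0 z=z$. Grünwald–Letnikov difference/sum of order $\alpha\in\mathbb{R}$: ${}_a^{\rm G}\nabla_k^\alpha z(k)=\sum_{i=0}^{k-a-1}(-1)^i\binom{\alpha}{i}z(k-i)$; empty sums are $0$, so this equals $0$ at $k=a,a-1,\dots$. For $\alpha\in(n-1,n)$, Riemann–Liouville: ${}_a^{\rm R}\nabla_k^\alpha z(k)=\nabla^n\,{}_a^{\rm G}\nabla_k^{\alpha-n}z(k)$; Caputo: ${}_a^{\rm C}\nabla_k^\alpha z(k)={}_a^{\rm G}\nabla_k^{\alpha-n}\nabla^n z(k)$. Tempered versions, with tempered function $w$ (nowhere zero): for each of the operators $D$ among $\nabla^n$, ${}_a^{\rm G}\nabla_k^\alpha$, ${}_a^{\rm R}\nabla_k^\alpha$, ${}_a^{\rm C}\nabla_k^\alpha$ the tempered operator (written with the extra superscript $w(k)$) sends $x$ to $w^{-1}(k)\,D[w(k)x(k)]$, where $w^{-1}(k)=1/w(k)$. *)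

theory Defs
  imports "HOL-Analysis.Analysis"
begin

text \<open>
  Functions on the grid \<open>\<int>\<^sub>a\<close> are represented by total functions on the reals. All operators
  below, evaluated at a point of the grid, use only values at points of the grid.
\<close>

definition Ngrid :: "real \<Rightarrow> real set" where
  "Ngrid b = {b + real j | j::nat. True}"

definition Zgrid :: "real \<Rightarrow> real set" where
  "Zgrid a = {a + real_of_int j | j::int. True}"

text \<open>
  \<open>Gamma\<close> is \<open>0\<close> at its poles and division by \<open>0\<close> gives \<open>0\<close>, so this is the intended
  function only when neither \<open>p\<close> nor \<open>p + q\<close> is a non-positive integer.
\<close>

definition rising :: "real \<Rightarrow> real \<Rightarrow> real" where
  "rising p q = Gamma (p + q) / Gamma p"

definition nabla :: "nat \<Rightarrow> (real \<Rightarrow> real) \<Rightarrow> real \<Rightarrow> real" where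
  "nabla n z k = (\<Sum>i=0..n. (-1) ^ i * real (n choose i) * z (k - real i))"

text \<open>
  The index set is written with a real inequality, so that the sum is empty for \<open>k \<le> a\<close>,
  where a truncated upper bound would leave the term \<open>i = 0\<close>.
\<close>

definition GL_diff :: "real \<Rightarrow> real \<Rightarrow> (real \<Rightarrow> real) \<Rightarrow> real \<Rightarrow> real" where
  "GL_diff a \<alpha> z k =
     (\<Sum>i\<in>{i::nat. real i \<le> k - a - 1}. (-1) ^ i * (\<alpha> gchoose i) * z (k - real i))"

text \<open>
  The Riemann--Liouville and Caputo differences of order \<open>\<alpha>\<close> are the following with the
  unique \<open>n\<close> such that \<open>n - 1 < \<alpha> < n\<close>.
\<close>

definition RL_diff :: "nat \<Rightarrow> real \<Rightarrow> real \<Rightarrow> (real \<Rightarrow> real) \<Rightarrow> real \<Rightarrow> real" where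
  "RL_diff n a \<alpha> z = nabla n (GL_diff a (\<alpha> - real n) z)"

definition Caputo_diff :: "nat \<Rightarrow> real \<Rightarrow> real \<Rightarrow> (real \<Rightarrow> real) \<Rightarrow> real \<Rightarrow> real" where
  "Caputo_diff n a \<alpha> z = GL_diff a (\<alpha> - real n) (nabla n z)"

definition tempered ::
  "(real \<Rightarrow> real) \<Rightarrow> ((real \<Rightarrow> real) \<Rightarrow> real \<Rightarrow> real) \<Rightarrow> (real \<Rightarrow> real) \<Rightarrow> real \<Rightarrow> real" where
  "tempered w D x k = 1 / w k * D (\<lambda>t. w t * x t) k"

end

theory Submission
  imports Defs
begin

text \<open>
  At \<open>k = a + 1 + N\<close> the coefficient of \<open>\<nabla>\<^sup>i z(k)\<close> in (1) is
  \<open>(\<alpha> gchoose i) * ((N - \<alpha>) gchoose (N - i))\<close>. Expanding \<open>\<nabla>\<^sup>i\<close>, trinomial revision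
  \<open>(\<alpha> gchoose i) * (i choose j) = (\<alpha> gchoose j) * ((\<alpha> - j) gchoose (i - j))\<close> and Vandermonde's
  identity collapse the coefficient of \<open>(-1)\<^sup>j z(k - j)\<close> to \<open>\<alpha> gchoose j\<close>. Vandermonde's identity
  also gives the composition rule \<open>\<nabla>\<^sup>n \<nabla>\<^sup>\<beta> = \<nabla>\<^sup>n\<^sup>+\<^sup>\<beta>\<close>, which reduces (2) and (3) to (1).
\<close>

text \<open>The upper arguments \<open>\<alpha> - j\<close> and \<open>N - \<alpha>\<close> left by
  trinomial revision add up to \<open>N - j\<close>, which is also the total lower index of the
  convolution. Vandermonde's identity therefore gives \<open>(N - j) gchoose (N - j) = 1\<close>,
  and only the factor pulled out survives.\<close>

lemma gbinomial_trinomial_revision_sum: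
  fixes \<alpha> :: real
  assumes "j \<le> N"
  shows "(\<Sum>i=j..N. (\<alpha> gchoose i) * ((real N - \<alpha>) gchoose (N - i)) * real (i choose j)) = \<alpha> gchoose j"
proof -
  have "(\<Sum>i=j..N. (\<alpha> gchoose i) * ((real N - \<alpha>) gchoose (N - i)) * real (i choose j))
      = (\<Sum>i=j..N. (\<alpha> gchoose j) * (((\<alpha> - real j) gchoose (i - j)) * ((real N - \<alpha>) gchoose (N - i))))"
  proof (rule sum.cong)
    fix i assume "i \<in> {j..N}"
    then have "(\<alpha> gchoose i) * (of_nat i gchoose j) = (\<alpha> gchoose j) * ((\<alpha> - of_nat j) gchoose (i - j))"
      by (intro gbinomial_trinomial_revision) simp
    then show "(\<alpha> gchoose i) * ((real N - \<alpha>) gchoose (N - i)) * real (i choose j)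
      = (\<alpha> gchoose j) * (((\<alpha> - real j) gchoose (i - j)) * ((real N - \<alpha>) gchoose (N - i)))"
      by (simp add: binomial_gbinomial mult_ac)
  qed simp
  also have "\<dots> = (\<alpha> gchoose j) * (\<Sum>i=j..N. ((\<alpha> - real j) gchoose (i - j)) * ((real N - \<alpha>) gchoose (N - i)))"
    by (simp add: sum_distrib_left)
  also have "(\<Sum>i=j..N. ((\<alpha> - real j) gchoose (i - j)) * ((real N - \<alpha>) gchoose (N - i)))
      = (\<Sum>i\<le>N - j. ((\<alpha> - real j) gchoose i) * ((real N - \<alpha>) gchoose (N - j - i)))"
    by (rule sum.reindex_bij_witness[where i = "\<lambda>i. i + j" and j = "\<lambda>i. i - j"]) (use assms in auto)
  also have "\<dots> = (\<alpha> - real j + (real N - \<alpha>)) gchoose (N - j)"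
    by (rule gbinomial_Vandermonde[unfolded atLeast0AtMost])
  also have "\<alpha> - real j + (real N - \<alpha>) = real (N - j)"
    using assms by (simp add: of_nat_diff)
  also have "real (N - j) gchoose (N - j) = 1"
    by (simp flip: binomial_gbinomial)
  finally show ?thesis by simp
qed

text \<open>\<open>Gamma (N + 1 - \<alpha>)\<close> and \<open>Gamma (i - \<alpha> + 1)\<close> have
  arguments differing by the integer \<open>N - i\<close>, so their quotient is a Pochhammer symbol;
  the remaining factor \<open>Gamma (N + 1 - i)\<close> is \<open>fact (N - i)\<close>. The
  condition on \<open>\<alpha>\<close> keeps \<open>i - \<alpha> + 1\<close> off the poles, where
  \<open>Gamma\<close> has the default value 0.\<close>

lemma rising_over_Gamma:
  fixes \<alpha> :: real
  assumes "\<alpha> \<notin> {real m | m::nat. m \<ge> 1}" and "i \<le> N"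
  shows "rising (real N + 1 - real i) (real i - \<alpha>) / Gamma (real i - \<alpha> + 1)
    = (real N - \<alpha>) gchoose (N - i)"
proof -
  let ?c = "real i - \<alpha> + 1"
  have c: "?c \<notin> \<int>\<^sub>\<le>\<^sub>0"
  proof
    assume "?c \<in> \<int>\<^sub>\<le>\<^sub>0"
    then obtain m :: nat where "?c = - of_nat m" by (rule nonpos_Ints_cases')
    then have "\<alpha> = real (i + m + 1)" by simp
    moreover have "i + m + 1 \<ge> 1" by simp
    ultimately show False using assms(1) by blast
  qed
  have "rising (real N + 1 - real i) (real i - \<alpha>) / Gamma ?c
      = Gamma (?c + of_nat (N - i)) / Gamma ?c / Gamma (real N + 1 - real i)"
    using assms(2) by (simp add: rising_def of_nat_diff algebra_simps)
  also have "Gamma (?c + of_nat (N - i)) / Gamma ?c = pochhammer ?c (N - i)"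
    using pochhammer_Gamma[OF c] by simp
  also have "Gamma (real N + 1 - real i) = fact (N - i)"
    using assms(2) Gamma_fact[of "N - i", where ?'a = real] by (simp add: of_nat_diff algebra_simps)
  also have "pochhammer ?c (N - i) / fact (N - i) = (real N - \<alpha>) gchoose (N - i)"
    using assms(2) by (simp add: gbinomial_pochhammer' of_nat_diff algebra_simps)
  finally show ?thesis .
qed

lemma GL_diff_grid:
  assumes "k = a + 1 + real N"
  shows "GL_diff a \<alpha> z k = (\<Sum>i\<le>N. (-1) ^ i * (\<alpha> gchoose i) * z (k - real i))"
proof -
  have "{i::nat. real i \<le> k - a - 1} = {..N}" using assms by auto
  then show ?thesis by (simp add: GL_diff_def)
qed

lemma GL_diff_eq_0: "k < a + 1 \<Longrightarrow> GL_diff a \<alpha> z k = 0"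
proof -
  assume "k < a + 1"
  then have "{i::nat. real i \<le> k - a - 1} = {}" by auto
  then show ?thesis by (simp add: GL_diff_def)
qed

text \<open>The coefficients \<open>n gchoose i\<close> vanish for \<open>i > n\<close>, so the
  truncation at \<open>N\<close> loses nothing as long as \<open>n \<le> N\<close>.\<close>

lemma nabla_eq_GL_diff:
  assumes "k = a + 1 + real N" and "n \<le> N"
  shows "nabla n z k = GL_diff a (real n) z k"
  unfolding nabla_def GL_diff_grid[OF assms(1)] using assms(2)
  by (intro sum.mono_neutral_cong_left) (auto simp flip: binomial_gbinomial)

lemma nabla_GL_diff:
  assumes k: "k = a + 1 + real N"
  shows "nabla n (GL_diff a \<beta> z) k = GL_diff a (real n + \<beta>) z k"
proof -
  have "nabla n (GL_diff a \<beta> z) k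
      = (\<Sum>i\<le>N. (-1) ^ i * (real n gchoose i) * GL_diff a \<beta> z (k - real i))"
    \<comment> \<open>The ranges \<open>0..n\<close> and \<open>..N\<close> may differ in either
      direction: the binomial vanishes for \<open>i > n\<close>, and for \<open>i > N\<close> the
      point \<open>k - i\<close> is at most \<open>a\<close>, where the inner sum is empty.\<close>
    unfolding nabla_def
    by (rule sum.mono_neutral_cong)
       (use k in \<open>auto simp: GL_diff_eq_0 simp flip: binomial_gbinomial\<close>)
  also have "\<dots> = (\<Sum>i\<le>N. \<Sum>j\<le>N - i.
      (-1) ^ (i + j) * ((real n gchoose i) * (\<beta> gchoose j)) * z (k - real (i + j)))"
  proof (rule sum.cong)
    fix i assume "i \<in> {..N}"
    then have "k - real i = a + 1 + real (N - i)" using k by (simp add: of_nat_diff)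
    from GL_diff_grid[OF this]
    show "(-1) ^ i * (real n gchoose i) * GL_diff a \<beta> z (k - real i)
      = (\<Sum>j\<le>N - i. (-1) ^ (i + j) * ((real n gchoose i) * (\<beta> gchoose j)) * z (k - real (i + j)))"
      by (simp add: sum_distrib_left power_add algebra_simps)
  qed simp
  \<comment> \<open>Regrouping by the total shift \<open>m = i + j\<close> turns the coefficients
    into Vandermonde convolutions.\<close>
  also have "\<dots> = (\<Sum>m\<le>N. \<Sum>i\<le>m.
      (-1) ^ m * ((real n gchoose i) * (\<beta> gchoose (m - i))) * z (k - real m))"
    unfolding sum.Sigma[OF finite_atMost ballI[OF finite_atMost]]
    by (rule sum.reindex_bij_witness
          [where i = "\<lambda>(m, i). (i, m - i)" and j = "\<lambda>(i, j). (i + j, i)"])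
       auto
  also have "\<dots> = (\<Sum>m\<le>N. (-1) ^ m * ((real n + \<beta>) gchoose m) * z (k - real m))"
    by (simp flip: sum_distrib_left sum_distrib_right gbinomial_Vandermonde add: atLeast0AtMost)
  finally show ?thesis by (simp add: GL_diff_grid[OF k])
qed

lemma nabla_nabla: "nabla m (nabla n z) k = nabla (m + n) z k"
proof -
  \<comment> \<open>\<open>nabla\<close> has no base point, so one may be chosen: it lies low enough
    that each \<open>k - i\<close> with \<open>i \<le> m\<close> is still at least \<open>n\<close>
    steps above \<open>a + 1\<close>, as the conversion to \<open>GL_diff\<close> requires.\<close>
  define a where "a = k - 1 - real (m + n)"
  have k: "k = a + 1 + real (m + n)" by (simp add: a_def)
  have "nabla n z (k - real i) = GL_diff a (real n) z (k - real i)" if "i \<le> m" for i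
    by (rule nabla_eq_GL_diff[where N = "m + n - i"]) (use that k in \<open>auto simp: of_nat_diff\<close>)
  then have "nabla m (nabla n z) k = nabla m (GL_diff a (real n) z) k"
    by (simp add: nabla_def[of m])
  also have "\<dots> = nabla (m + n) z k"
    using nabla_GL_diff[OF k] nabla_eq_GL_diff[OF k] by simp
  finally show ?thesis .
qed

text \<open>This is (1) before tempering, for arbitrary \<open>z\<close>. It is later applied to
  \<open>w * x\<close>, and for Caputo to its \<open>n\<close>-th difference.\<close>

lemma GL_diff_nabla_expansion:
  assumes \<alpha>: "\<alpha> \<notin> {real m | m::nat. m \<ge> 1}" and k: "k = a + 1 + real N"
  shows "GL_diff a \<alpha> z k = (\<Sum>i\<le>N.
    (\<alpha> gchoose i) * (rising (k - a - real i) (real i - \<alpha>) / Gamma (real i - \<alpha> + 1)) * nabla i z k)"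
proof -
  let ?c = "\<lambda>i. (\<alpha> gchoose i) * ((real N - \<alpha>) gchoose (N - i))"
  have "k - a = real N + 1" using k by simp
  then have "(\<Sum>i\<le>N.
      (\<alpha> gchoose i) * (rising (k - a - real i) (real i - \<alpha>) / Gamma (real i - \<alpha> + 1)) * nabla i z k)
      = (\<Sum>i\<le>N. ?c i * nabla i z k)"
    using rising_over_Gamma[OF \<alpha>] by (intro sum.cong) auto
  also have "\<dots> = (\<Sum>i\<le>N. \<Sum>j\<le>i. (-1) ^ j * z (k - real j) * (?c i * real (i choose j)))"
    by (simp add: nabla_def sum_distrib_left atLeast0AtMost mult_ac)
  \<comment> \<open>Summing over \<open>i\<close> first, for a fixed shift \<open>j\<close>,
    isolates the coefficient of \<open>z (k - j)\<close>.\<close>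
  also have "\<dots> = (\<Sum>j\<le>N. \<Sum>i=j..N. (-1) ^ j * z (k - real j) * (?c i * real (i choose j)))"
    unfolding sum.Sigma[OF finite_atMost ballI[OF finite_atMost]]
      sum.Sigma[OF finite_atMost ballI[OF finite_atLeastAtMost]]
    by (rule sum.reindex_bij_witness[where i = prod.swap and j = prod.swap]) auto
  also have "\<dots> = (\<Sum>j\<le>N. (-1) ^ j * (\<alpha> gchoose j) * z (k - real j))"
    by (intro sum.cong)
       (simp_all flip: sum_distrib_left add: gbinomial_trinomial_revision_sum)
  finally show ?thesis by (simp add: GL_diff_grid[OF k])
qed

theorem theorem9:
  fixes a k :: real and x w :: "real \<Rightarrow> real"
  assumes w_nz: "\<forall>t\<in>Zgrid a. w t \<noteq> 0"
    and k: "k \<in> Ngrid (a + 1)"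
  shows
    "(\<forall>\<alpha>::real. \<alpha> \<notin> {real m | m::nat. m \<ge> 1} \<longrightarrow>
        tempered w (GL_diff a \<alpha>) x k =
          (\<Sum>i\<in>{i::nat. real i \<le> k - a - 1}.
             (\<alpha> gchoose i) * (rising (k - a - real i) (real i - \<alpha>) / Gamma (real i - \<alpha> + 1))
               * tempered w (nabla i) x k))
     \<and> (\<forall>(n::nat) (\<alpha>::real). n \<ge> 1 \<longrightarrow> \<alpha> \<in> {real n - 1<..<real n} \<longrightarrow>
        tempered w (RL_diff n a \<alpha>) x k =
          (\<Sum>i\<in>{i::nat. real i \<le> k - a - 1}.
             (\<alpha> gchoose i) * (rising (k - a - real i) (real i - \<alpha>) / Gamma (real i - \<alpha> + 1))
               * tempered w (nabla i) x k))
     \<and> (\<forall>(n::nat) (\<alpha>::real). n \<ge> 1 \<longrightarrow> \<alpha> \<in> {real n - 1<..<real n} \<longrightarrow>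
        tempered w (Caputo_diff n a \<alpha>) x k =
          (\<Sum>i\<in>{i::nat. n \<le> i \<and> real i \<le> k - a - 1 + real n}.
             ((\<alpha> - real n) gchoose (i - n))
               * (rising (k - a - real i + real n) (real i - \<alpha>) / Gamma (real i - \<alpha> + 1))
               * tempered w (nabla i) x k))"
proof -
  obtain N where N: "k = a + 1 + real N" using k by (auto simp: Ngrid_def)
  then have I: "{i::nat. real i \<le> k - a - 1} = {..N}" by auto
  have GL: "tempered w (GL_diff a \<alpha>) x k =
      (\<Sum>i\<in>{i::nat. real i \<le> k - a - 1}.
         (\<alpha> gchoose i) * (rising (k - a - real i) (real i - \<alpha>) / Gamma (real i - \<alpha> + 1))
           * tempered w (nabla i) x k)"
    if "\<alpha> \<notin> {real m | m::nat. m \<ge> 1}" for \<alpha>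
    \<comment> \<open>The expansion is linear in the differences of \<open>w * x\<close> at the
      single point \<open>k\<close>, so the factor \<open>1 / w k\<close> passes into each
      term.\<close>
    unfolding I tempered_def GL_diff_nabla_expansion[OF that N]
    by (simp add: sum_divide_distrib)
  have RL: "tempered w (RL_diff n a \<alpha>) x k =
      (\<Sum>i\<in>{i::nat. real i \<le> k - a - 1}.
         (\<alpha> gchoose i) * (rising (k - a - real i) (real i - \<alpha>) / Gamma (real i - \<alpha> + 1))
           * tempered w (nabla i) x k)"
    if \<alpha>: "\<alpha> \<in> {real n - 1<..<real n}" for n \<alpha>
  proof -
    \<comment> \<open>No integer lies strictly between \<open>n - 1\<close> and \<open>n\<close>, so
      (1) covers this order.\<close>
    have "\<alpha> \<noteq> real m" for m :: nat
    proof
      assume "\<alpha> = real m"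
      with \<alpha> have "m < n" "n < m + 1" by auto
      then show False by simp
    qed
    then have "\<alpha> \<notin> {real m | m::nat. m \<ge> 1}" by blast
    moreover have "tempered w (RL_diff n a \<alpha>) x k = tempered w (GL_diff a \<alpha>) x k"
      by (simp add: tempered_def RL_diff_def nabla_GL_diff[OF N])
    ultimately show ?thesis using GL by simp
  qed
  have Caputo: "tempered w (Caputo_diff n a \<alpha>) x k =
      (\<Sum>i\<in>{i::nat. n \<le> i \<and> real i \<le> k - a - 1 + real n}.
         ((\<alpha> - real n) gchoose (i - n))
           * (rising (k - a - real i + real n) (real i - \<alpha>) / Gamma (real i - \<alpha> + 1))
           * tempered w (nabla i) x k)"
    if \<alpha>: "\<alpha> \<in> {real n - 1<..<real n}" for n \<alpha>
  proof -
    \<comment> \<open>The order \<open>\<alpha> - n\<close> is negative, so the expansion applies to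
      it with \<open>nabla n\<close> of \<open>w * x\<close> as the function.\<close>
    from \<alpha> have neg: "\<alpha> - real n \<notin> {real m | m::nat. m \<ge> 1}" by auto
    have "tempered w (Caputo_diff n a \<alpha>) x k = (\<Sum>i\<le>N. ((\<alpha> - real n) gchoose i)
        * (rising (k - a - real i) (real i - (\<alpha> - real n)) / Gamma (real i - (\<alpha> - real n) + 1))
        * tempered w (nabla (i + n)) x k)"
      unfolding tempered_def Caputo_diff_def GL_diff_nabla_expansion[OF neg N]
      by (simp add: nabla_nabla sum_divide_distrib)
    also have "\<dots> = (\<Sum>i\<in>{i::nat. n \<le> i \<and> real i \<le> k - a - 1 + real n}.
         ((\<alpha> - real n) gchoose (i - n))
           * (rising (k - a - real i + real n) (real i - \<alpha>) / Gamma (real i - \<alpha> + 1))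
           * tempered w (nabla i) x k)"
      \<comment> \<open>Shifting the index by \<open>n\<close> turns
        \<open>i - (\<alpha> - n)\<close> into \<open>i - \<alpha>\<close> and moves the range from
        \<open>0..N\<close> to \<open>n..N + n\<close>.\<close>
      by (rule sum.reindex_bij_witness[where i = "\<lambda>i. i - n" and j = "\<lambda>i. i + n"])
         (use N in \<open>auto simp: algebra_simps\<close>)
    finally show ?thesis .
  qed
  show ?thesis using GL RL Caputo by blast
qed

end
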